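(* Let $(G,s,t)$ be a flow network with $G=(V,E)$, let $L$ be a distributive lattice, and let $c:E\to L$ be a capacity function. Let $\mathcal{P}$ be the set of all directed paths from $s$ to $t$ in $G$, and let $\mathcal{C}$ be the set of all cuts separating $s$ from $t$. Then $$\bigvee_{P\in\mathcal{P}}\ \bigwedge_{e\in P} c(e)\;=\;\bigwedge_{C\in\mathcal{C}}\ \bigvee_{e\in C} c(e).$$
   Context: A flow network is a tuple $(G,s,t)$ such that: (1) $G=(V,E)$ is a finite directed graph, with edges written as ordered pairs $(u,v)$ of vertices, without self-loops or directed cycles; (2) $s,t\in V$ are distinct vertices, called the source and the sink; (3) all edges incident to $s$ are outgoing and all edges incident to $t$ are incoming; (4) for every $v\in V\setminus\{s,t\}$ there exist directed paths in $G$ from $s$ to $v$ and from $v$ to $t$. It is assumed that $G$ has at least one directed path from $s$ to $t$ (so $\mathcal{P}$ is non-empty; given (1)-(4) this only excludes the case $V=\{s,t\}$, $E=\emptyset$). A cut separating $s$ from $t$ is a partition $C=(S,T)$ of $V$ with $s\in S$ and $t\in T$. For an edge $e=(u,v)\in E$, one writes $e\in C$ if $u\in S$ and $v\in T$. For a path $P$, $e\in P$ means that $e$ is one of the edges traversed by $P$. A lattice is a partially ordered set in which any two elements have a join $\vee$ (least upper bound) and a meet $\wedge$ (greatest lower bound); it is distributive if $a\vee(b\wedge c)=(a\vee b)\wedge(a\vee c)$ and $a\wedge(b\vee c)=(a\wedge b)\vee(a\wedge c)$ for all $a,b,c$. The lattice $L$ is not assumed complete or bounded; all joins and meets in the claim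 are over finite non-empty families. *)

theory Defs
  imports "Graph_Theory.Pair_Digraph"
begin

locale flow_network = pair_digraph G
  for G :: "'a pair_pre_digraph" +
  fixes s t :: 'a
  assumes acyclic: "\<nexists>p. cycle p"
    and source_in_verts: "s \<in> pverts G"
    and sink_in_verts: "t \<in> pverts G"
    and source_neq_sink: "s \<noteq> t"
    and source_outgoing: "\<And>u. (u, s) \<notin> parcs G"
    and sink_incoming: "\<And>v. (t, v) \<notin> parcs G"
    and path_from_source: "\<And>v. v \<in> pverts G - {s, t} \<Longrightarrow> \<exists>p. apath s p v"
    and path_to_sink: "\<And>v. v \<in> pverts G - {s, t} \<Longrightarrow> \<exists>p. apath v p t"

text \<open>A path is the list of the arcs it traverses.\<close>

definition st_paths :: "'a pair_pre_digraph \<Rightarrow> 'a \<Rightarrow> 'a \<Rightarrow> ('a \<times> 'a) awalk set" where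
  "st_paths G s t = {p. pre_digraph.apath (with_proj G) s p t}"

definition st_cuts :: "'a pair_pre_digraph \<Rightarrow> 'a \<Rightarrow> 'a \<Rightarrow> ('a set \<times> 'a set) set" where
  "st_cuts G s t = {(S, T). S \<union> T = pverts G \<and> S \<inter> T = {} \<and> s \<in> S \<and> t \<in> T}"

definition cut_arcs :: "'a pair_pre_digraph \<Rightarrow> 'a set \<times> 'a set \<Rightarrow> ('a \<times> 'a) set" where
  "cut_arcs G C = {(u, v) \<in> parcs G. u \<in> fst C \<and> v \<in> snd C}"

text \<open>
  The constants \<^const>\<open>Inf_fin\<close> and \<^const>\<open>Sup_fin\<close> are meaningful only on finite
  non-empty sets.  The next facts show that every family occurring in the min-cut formula
  is of this kind, once there is a path from \<open>s\<close> to \<open>t\<close>.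
\<close>

context flow_network
begin

lemma finite_st_paths: "finite (st_paths G s t)"
  unfolding st_paths_def using apaths_finite[of s t] by simp

lemma st_path_nonempty: "p \<in> st_paths G s t \<Longrightarrow> p \<noteq> []"
  using source_neq_sink by (auto simp: st_paths_def apath_Nil_iff)

lemma finite_st_cuts: "finite (st_cuts G s t)"
proof (rule finite_subset)
  show "st_cuts G s t \<subseteq> Pow (pverts G) \<times> Pow (pverts G)"
    by (auto simp: st_cuts_def)
qed (simp add: pair_finite_verts)

lemma st_cuts_nonempty: "st_cuts G s t \<noteq> {}"
proof -
  have "({s}, pverts G - {s}) \<in> st_cuts G s t"
    using source_in_verts sink_in_verts source_neq_sink by (auto simp: st_cuts_def)
  then show ?thesis by blast
qed

lemma finite_cut_arcs: "finite (cut_arcs G C)"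
  by (rule finite_subset[OF _ pair_finite_arcs]) (auto simp: cut_arcs_def)

lemma path_meets_cut:
  assumes "C \<in> st_cuts G s t" and "p \<in> st_paths G s t"
  shows "set p \<inter> cut_arcs G C \<noteq> {}"
proof -
  have *: "set q \<inter> cut_arcs G C \<noteq> {}" if "awalk u q t" "u \<in> fst C" for u q
    using that
  proof (induction q arbitrary: u)
    case Nil
    then show ?case using assms(1) by (auto simp: st_cuts_def awalk_Nil_iff)
  next
    case (Cons e q)
    then have e: "e \<in> parcs G" "fst e = u" and q: "awalk (snd e) q t"
      by (auto simp: awalk_Cons_iff)
    show ?case
    proof (cases "snd e \<in> fst C")
      case True
      then show ?thesis using Cons.IH[OF q] by auto
    next
      case False
      then have "snd e \<in> snd C"
        using assms(1) arc_snd_in_verts[OF e(1)] by (auto simp: st_cuts_def)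
      then show ?thesis
        using e Cons.prems(2) by (auto simp: cut_arcs_def)
    qed
  qed
  show ?thesis
    using *[of s p] assms by (auto simp: st_paths_def st_cuts_def apath_def)
qed

lemma cut_arcs_nonempty:
  "st_paths G s t \<noteq> {} \<Longrightarrow> C \<in> st_cuts G s t \<Longrightarrow> cut_arcs G C \<noteq> {}"
  using path_meets_cut by blast

end

end

theory Submission
  imports Defs
begin

text \<open>
  Every path meets every cut, so each path's meet lies below each cut's join; this gives
  one inequality in any lattice. For the other, distributivity turns the meet over all
  cuts of the joins of their arcs into the join, over all ways to choose one arc from
  each cut, of the meet of the chosen arcs (\<open>Inf_fin_Sup_fin_leI\<close>). Such a choice of
  arcs hits every cut and therefore contains a path from the source to the sink: otherwise
  the vertices reachable from the source along chosen arcs would form a cut that contains no chosen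
  arc (\<open>st_path_within_transversal\<close>). So each term of the expanded join lies
  below the meet along some path. This plays the part that augmenting paths play in
  the numerical max-flow min-cut theorem.
\<close>

text \<open>
  This is the inequality that matters in the expansion of a meet of joins over choice
  functions, written as a bound so that it can be used without describing the set of
  all choice functions. The extra meet with \<open>y\<close> is for the induction over \<open>I\<close>: it
  holds the join of the index just inserted while the induction hypothesis expands the
  others, since a distributive lattice need not have an implication that would move
  that join to the side of \<open>z\<close>.
\<close>

lemma Inf_fin_Sup_fin_leI_aux:
  fixes c :: "'b \<Rightarrow> 'l :: distrib_lattice"
  assumes "finite I" and "I \<noteq> {}"
    and "\<And>i. i \<in> I \<Longrightarrow> finite (A i)" and "\<And>i. i \<in> I \<Longrightarrow> A i \<noteq> {}"
    and "\<And>f. (\<And>i. i \<in> I \<Longrightarrow> f i \<in> A i) \<Longrightarrow> inf y (Inf_fin (c ` f ` I)) \<le> z"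
  shows "inf y (Inf_fin ((\<lambda>i. Sup_fin (c ` A i)) ` I)) \<le> z"
proof -
  \<comment> \<open>The only use of distributivity.\<close>
  have inf_Sup_le: "inf y (Sup_fin (c ` B)) \<le> z"
    if "finite B" "B \<noteq> {}" "\<And>b. b \<in> B \<Longrightarrow> inf y (c b) \<le> z" for y B
  proof -
    have eq: "inf y (Sup_fin (c ` B)) = Sup_fin {inf y a | a. a \<in> c ` B}"
      using that by (intro inf_Sup1_distrib) auto
    have "{inf y a | a. a \<in> c ` B} = (\<lambda>b. inf y (c b)) ` B"
      by auto
    then show ?thesis
      using that eq by (simp add: Sup_fin.bounded_iff)
  qed
  from assms show ?thesis
  proof (induction I arbitrary: y rule: finite_ne_induct)
    case (singleton i)
    have "inf y (c a) \<le> z" if "a \<in> A i" for a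
      using singleton(3)[of "\<lambda>_. a"] that by simp
    then show ?case
      using inf_Sup_le singleton(1,2) by simp
  next
    case (insert i I)
    let ?S = "Sup_fin (c ` A i)"
    have "inf (inf y ?S) (Inf_fin ((\<lambda>i. Sup_fin (c ` A i)) ` I)) \<le> z"
    proof (rule insert.IH)
      fix f assume f: "\<And>j. j \<in> I \<Longrightarrow> f j \<in> A j"
      have "inf (inf y (Inf_fin (c ` f ` I))) ?S \<le> z"
      proof (rule inf_Sup_le)
        fix a assume a: "a \<in> A i"
        have upd: "f(i := a) ` insert i I = insert a (f ` I)"
          using insert.hyps by (auto simp: image_iff)
        have "inf y (Inf_fin (c ` (f(i := a)) ` insert i I)) \<le> z"
          using a f by (intro insert.prems(3)) auto
        then show "inf (inf y (Inf_fin (c ` f ` I))) (c a) \<le> z"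
          unfolding upd using insert.hyps by (simp add: inf_aci)
      qed (use insert.prems in auto)
      then show "inf (inf y ?S) (Inf_fin (c ` f ` I)) \<le> z"
        by (simp add: inf_aci)
    qed (use insert.prems in auto)
    then show ?case
      using insert.hyps by (simp add: inf_aci)
  qed
qed

lemma Inf_fin_Sup_fin_leI:
  fixes c :: "'b \<Rightarrow> 'l :: distrib_lattice"
  assumes "finite I" and "I \<noteq> {}"
    and "\<And>i. i \<in> I \<Longrightarrow> finite (A i)" and "\<And>i. i \<in> I \<Longrightarrow> A i \<noteq> {}"
    and bound: "\<And>f. (\<And>i. i \<in> I \<Longrightarrow> f i \<in> A i) \<Longrightarrow> Inf_fin (c ` f ` I) \<le> z"
  shows "Inf_fin ((\<lambda>i. Sup_fin (c ` A i)) ` I) \<le> z"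
proof -
  let ?m = "Inf_fin ((\<lambda>i. Sup_fin (c ` A i)) ` I)"
  have "inf ?m ?m \<le> z"
    by (rule Inf_fin_Sup_fin_leI_aux) (use assms in \<open>auto intro: le_infI2\<close>)
  then show ?thesis by simp
qed

context flow_network
begin

text \<open>
  If the arcs in \<open>F\<close> did not lead from the source to the sink, then no arc of \<open>F\<close>
  would leave the set of vertices that they do reach, and this set would be one side of a cut
  that \<open>F\<close> misses.
\<close>

lemma st_path_within_transversal:
  assumes hits: "\<And>C. C \<in> st_cuts G s t \<Longrightarrow> F \<inter> cut_arcs G C \<noteq> {}"
  obtains p where "p \<in> st_paths G s t" and "set p \<subseteq> F"
proof -
  define R where "R = {v. \<exists>p. awalk s p v \<and> set p \<subseteq> F}"
  have "t \<in> R"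
  proof (rule ccontr)
    assume "t \<notin> R"
    moreover have "s \<in> R"
      using source_in_verts by (auto simp: R_def awalk_Nil_iff intro!: exI[of _ "[]"])
    moreover have "R \<subseteq> pverts G"
      by (auto simp: R_def)
    ultimately have "(R, pverts G - R) \<in> st_cuts G s t"
      using sink_in_verts by (auto simp: st_cuts_def)
    then obtain u v where uv: "(u, v) \<in> F" "(u, v) \<in> parcs G" "u \<in> R" "v \<notin> R"
      using hits by (fastforce simp: cut_arcs_def)
    then obtain p where p: "awalk s p u" "set p \<subseteq> F"
      by (auto simp: R_def)
    have "awalk u [(u, v)] v"
      using uv(2) by (auto simp: awalk_Cons_iff awalk_Nil_iff dest: arc_fst_in_verts arc_snd_in_verts)
    then have "awalk s (p @ [(u, v)]) v"
      using p(1) by auto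
    then have "v \<in> R"
      using p(2) uv(1) by (auto simp: R_def intro!: exI[of _ "p @ [(u, v)]"])
    with uv(4) show False ..
  qed
  then obtain p where p: "awalk s p t" "set p \<subseteq> F"
    by (auto simp: R_def)
  \<comment> \<open>A walk may repeat vertices; cutting out its detours keeps it inside \<open>F\<close>.\<close>
  show thesis
  proof
    show "awalk_to_apath p \<in> st_paths G s t"
      using apath_awalk_to_apath[OF p(1)] by (simp add: st_paths_def)
    show "set (awalk_to_apath p) \<subseteq> F"
      using awalk_to_apath_subset[OF p(1)] p(2) by blast
  qed
qed

end

theorem theorem3:
  fixes G :: "'a pair_pre_digraph" and s t :: 'a
    and c :: "'a \<times> 'a \<Rightarrow> 'l :: distrib_lattice"
  assumes "flow_network G s t"
    and "st_paths G s t \<noteq> {}"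
  shows "Sup_fin ((\<lambda>P. Inf_fin (c ` set P)) ` st_paths G s t)
       = Inf_fin ((\<lambda>C. Sup_fin (c ` cut_arcs G C)) ` st_cuts G s t)"
proof -
  interpret flow_network G s t by fact
  show ?thesis
  proof (rule antisym)
    have "Inf_fin (c ` set P) \<le> Sup_fin (c ` cut_arcs G C)"
      if P: "P \<in> st_paths G s t" and C: "C \<in> st_cuts G s t" for P C
    proof -
      obtain e where e: "e \<in> set P" "e \<in> cut_arcs G C"
        using path_meets_cut[OF C P] by blast
      have "Inf_fin (c ` set P) \<le> c e"
        using e(1) by (intro Inf_fin.coboundedI) auto
      also have "c e \<le> Sup_fin (c ` cut_arcs G C)"
        using e(2) by (intro Sup_fin.coboundedI) (auto simp: finite_cut_arcs)
      finally show ?thesis .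
    qed
    then show "Sup_fin ((\<lambda>P. Inf_fin (c ` set P)) ` st_paths G s t)
        \<le> Inf_fin ((\<lambda>C. Sup_fin (c ` cut_arcs G C)) ` st_cuts G s t)"
      using assms(2) st_cuts_nonempty
      by (simp add: Sup_fin.bounded_iff Inf_fin.bounded_iff finite_st_paths finite_st_cuts)
  next
    show "Inf_fin ((\<lambda>C. Sup_fin (c ` cut_arcs G C)) ` st_cuts G s t)
        \<le> Sup_fin ((\<lambda>P. Inf_fin (c ` set P)) ` st_paths G s t)"
    proof (rule Inf_fin_Sup_fin_leI)
      fix f assume f: "\<And>C. C \<in> st_cuts G s t \<Longrightarrow> f C \<in> cut_arcs G C"
      obtain P where P: "P \<in> st_paths G s t" "set P \<subseteq> f ` st_cuts G s t"
        using st_path_within_transversal[of "f ` st_cuts G s t"] f by blast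
      have "Inf_fin (c ` f ` st_cuts G s t) \<le> Inf_fin (c ` set P)"
        using P st_path_nonempty
        by (intro Inf_fin.subset_imp) (auto simp: finite_st_cuts)
      also have "\<dots> \<le> Sup_fin ((\<lambda>P. Inf_fin (c ` set P)) ` st_paths G s t)"
        using P(1) by (intro Sup_fin.coboundedI) (auto simp: finite_st_paths)
      finally show "Inf_fin (c ` f ` st_cuts G s t)
          \<le> Sup_fin ((\<lambda>P. Inf_fin (c ` set P)) ` st_paths G s t)" .
    qed (simp_all add: finite_st_cuts st_cuts_nonempty finite_cut_arcs
        cut_arcs_nonempty[OF assms(2)])
  qed
qed

end
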